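(* Let $n\ge 2$ and let $\mathcal{Q}$ be an $n$-cube, with $V$ vertices and $F$ facets, that circumscribes a unit $n$-sphere. Let $N$ be the total number of line segments whose endpoints are centers of two distinct facets of $\mathcal{Q}$, and let $s_1,\dots,s_N$ be the lengths of these line segments (one entry for each segment). Then $$\prod_{i=1}^{N}s_i^2=V^F .$$
   Context: A unit $n$-sphere is a sphere of radius $1$ in $\mathbb{R}^n$ (so a "2-sphere" is a circle). An $n$-cube is the regular $n$-dimensional hypercube in $\mathbb{R}^n$; its facets are its $(n-1)$-dimensional faces. It circumscribes the sphere if all its facets are tangent to the sphere (they touch the sphere at their centers, and the sphere's center is the center of the cube). *)

theory Defs
  imports "HOL-Analysis.Analysis"
begin

text \<open>A regular hypercube of full dimension: the image of the standard cube
  \<open>[0,1]\<^sup>n\<close> under a similarity (arbitrary position, orientation and edge length \<open>s\<close>).\<close>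

definition hypercube :: "'a::euclidean_space set \<Rightarrow> bool" where
  "hypercube Q \<longleftrightarrow>
     (\<exists>(a :: 'a) (s :: real) (f :: 'a \<Rightarrow> 'a).
        s > 0 \<and> orthogonal_transformation f \<and> Q = (\<lambda>x. a + s *\<^sub>R f x) ` cbox 0 One)"

definition vertices :: "'a::euclidean_space set \<Rightarrow> 'a set" where
  "vertices P = {v. v extreme_point_of P}"

definition facets :: "'a::euclidean_space set \<Rightarrow> 'a set set" where
  "facets P = {F. F facet_of P}"

text \<open>The mean of the vertices. Used for a cube and for its facets, which are again cubes, so it
  is their center of symmetry.\<close>

definition center :: "'a::euclidean_space set \<Rightarrow> 'a" where
  "center P = (\<Sum>v\<in>vertices P. v) /\<^sub>R real (card (vertices P))"

text \<open>Tangency at \<open>p\<close>: \<open>p\<close> is a point of the facet \<open>F\<close>, and it is the only point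
  that the supporting hyperplane (the affine hull of \<open>F\<close>) shares with the sphere.\<close>

definition tangent_at :: "'a::euclidean_space set \<Rightarrow> 'a \<Rightarrow> real \<Rightarrow> 'a \<Rightarrow> bool" where
  "tangent_at F c r p \<longleftrightarrow> p \<in> F \<and> affine hull F \<inter> sphere c r = {p}"

definition circumscribes :: "'a::euclidean_space set \<Rightarrow> 'a \<Rightarrow> real \<Rightarrow> bool" where
  "circumscribes Q c r \<longleftrightarrow> center Q = c \<and> (\<forall>F\<in>facets Q. tangent_at F c r (center F))"

text \<open>Segments are represented as point sets, so that \<open>[a,b]\<close> and \<open>[b,a]\<close> are the same
  segment.\<close>

definition facet_center_segments :: "'a::euclidean_space set \<Rightarrow> 'a set set" where
  "facet_center_segments Q =
     {closed_segment (center F) (center G) | F G. F \<in> facets Q \<and> G \<in> facets Q \<and> F \<noteq> G}"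

definition segment_length :: "'a::euclidean_space set \<Rightarrow> real" where
  "segment_length S = (THE l. \<exists>a b. S = closed_segment a b \<and> l = dist a b)"

lemma segment_length_closed_segment [simp]: "segment_length (closed_segment a b) = dist a b"
  unfolding segment_length_def
  by (rule the_equality) (auto simp: dist_commute doubleton_eq_iff)

end

theory Submission
  imports Defs
begin

text \<open>Let $n$ be the dimension. The facet centers of an $n$-cube circumscribing a unit sphere with
  center \<open>m\<close> are the $2n$ points \<open>m + u\<close> and \<open>m - u\<close>, where \<open>u\<close> runs
  through an orthonormal basis: they are the vertices of a cross-polytope. Hence a pair of distinct
  facet centers is either opposite, with squared distance 4, or orthogonal as seen from \<open>m\<close>,
  with squared distance 2. There are $n$ opposite pairs and ${2n \choose 2} - n = 2n(n-1)$
  orthogonal ones, so the product is $4^n \cdot 2^{2n(n-1)} = 2^{2n^2} = (2^n)^{2n}$. Since the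
  cube has $2^n$ vertices and $2n$ facets, this is \<open>V ^ F\<close>.

  The geometry is done once, for the standard cube \<open>[-1,1]\<^sup>n\<close>: its facets lie on the
  hyperplanes \<open>v \<bullet> x = 1\<close> for \<open>v\<close> or \<open>- v\<close> a basis vector (lemma
  \<open>facets_std_cube\<close>), and such a facet has center \<open>v\<close> because the point reflection in
  \<open>v\<close> preserves it (lemma \<open>facet_std_cube\<close>). An injective affine map carries vertices,
  facets and centers along, every hypercube is the image of the standard cube under a similarity,
  and tangency to the unit sphere forces the ratio of that similarity to be 1. What remains is the
  count of pairs in \<open>prod_pairs_axis_vectors\<close>.\<close>

section \<open>Faces and centers under affine maps and point reflections\<close>

lemma polytope_vertices:
  fixes P :: "'a::euclidean_space set"
  assumes "polytope P"
  shows "finite (vertices P)" "P \<noteq> {} \<Longrightarrow> vertices P \<noteq> {}"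
  using finite_polyhedron_extreme_points[OF polytope_imp_polyhedron[OF assms]]
    extreme_point_exists_convex[of P] assms
  by (auto simp: vertices_def polytope_imp_compact polytope_imp_convex)

text \<open>The maps to which this is applied are the similarity that produces a hypercube from the standard
  cube, and the point reflections that determine the centers of the standard cube and its facets.\<close>

locale affine_embedding =
  fixes h :: "'a::euclidean_space \<Rightarrow> 'a" and c :: 'a
  assumes linear_part: "linear h" "inj h"
begin

definition g :: "'a \<Rightarrow> 'a" where "g x = c + h x"

lemma inj_g: "inj g"
  using linear_part(2) unfolding inj_def g_def by simp

lemma image_g: "g ` S = (+) c ` h ` S"
  by (simp add: g_def image_image)

lemma face_of_image: "g ` T face_of g ` S \<longleftrightarrow> T face_of S"
  by (simp add: image_g face_of_linear_image[OF linear_part])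

lemma facet_of_image: "g ` T facet_of g ` S \<longleftrightarrow> T facet_of S"
proof -
  have "aff_dim (g ` X) = aff_dim X" for X
    unfolding image_g by (simp add: aff_dim_translation_eq aff_dim_injective_linear_image linear_part)
  then show ?thesis
    by (simp add: facet_of_def face_of_image)
qed

text \<open>A vertex is a face that consists of one point, so images of faces already cover vertices.\<close>

lemma vertices_image: "vertices (g ` S) = g ` vertices S"
proof -
  have "g x extreme_point_of g ` S \<longleftrightarrow> x extreme_point_of S" for x
    using face_of_image[of "{x}" S] by (simp add: face_of_singleton)
  moreover have "x \<in> g ` S" if "x extreme_point_of g ` S" for x
    using that by (simp add: extreme_point_of_def)
  ultimately show ?thesis
    unfolding vertices_def by blast
qed

lemma facets_image: "facets (g ` S) = (`) g ` facets S"
proof -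
  have "T \<in> (`) g ` facets S" if "T facet_of g ` S" for T
  proof -
    have "T \<subseteq> g ` S" using that by (rule facet_of_imp_subset)
    then obtain U where "T = g ` U" by (auto simp: subset_image_iff)
    with that show ?thesis
      by (auto simp: facets_def facet_of_image)
  qed
  then show ?thesis
    by (auto simp: facets_def facet_of_image)
qed

lemma center_image:
  assumes "finite (vertices S)" "vertices S \<noteq> {}"
  shows "center (g ` S) = g (center S)"
proof -
  have "(\<Sum>v\<in>g ` vertices S. v) = (\<Sum>v\<in>vertices S. c + h v)"
    by (subst sum.reindex) (auto intro: inj_on_subset[OF inj_g] simp: g_def)
  also have "\<dots> = real (card (vertices S)) *\<^sub>R c + h (\<Sum>v\<in>vertices S. v)"
    using linear_part by (simp add: sum.distrib linear_sum sum_constant_scaleR)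
  finally have "(\<Sum>v\<in>vertices (g ` S). v)
      = real (card (vertices S)) *\<^sub>R c + h (\<Sum>v\<in>vertices S. v)"
    by (simp add: vertices_image)
  moreover have "card (vertices (g ` S)) = card (vertices S)"
    by (simp add: vertices_image card_image inj_on_subset[OF inj_g])
  ultimately show ?thesis
    using assms linear_part
    by (simp add: center_def g_def linear_scale scaleR_add_right)
qed

end

text \<open>The reflection in \<open>p\<close> permutes the vertices of \<open>S\<close>, hence fixes their mean; its
  only fixed point is \<open>p\<close>. This avoids computing the vertices of any facet.\<close>

lemma center_point_symmetric:
  fixes S :: "'a::euclidean_space set"
  assumes "polytope S" "S \<noteq> {}" and symm: "\<And>x. x \<in> S \<Longrightarrow> 2 *\<^sub>R p - x \<in> S"
  shows "center S = p"
proof -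
  interpret affine_embedding uminus "2 *\<^sub>R p"
    by unfold_locales (auto intro: linear_uminus simp: bij_uminus bij_is_inj)
  have "g ` S = S"
  proof
    show "S \<subseteq> g ` S"
    proof
      fix x assume "x \<in> S"
      then show "x \<in> g ` S"
        using symm[of x] by (intro image_eqI[of _ _ "2 *\<^sub>R p - x"]) (auto simp: g_def)
    qed
  qed (use symm in \<open>auto simp: g_def\<close>)
  moreover have "finite (vertices S)" "vertices S \<noteq> {}"
    using assms by (simp_all add: polytope_vertices)
  ultimately have "center S = 2 *\<^sub>R p - center S"
    using center_image[of S] by (simp add: g_def)
  then have "2 *\<^sub>R center S = 2 *\<^sub>R p"
    by (simp add: scaleR_2 algebra_simps)
  then show ?thesis by simp
qed

section \<open>The standard cube and its polar cross-polytope\<close>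

text \<open>The vertices of the standard cross-polytope. They serve both as the outer facet normals and
  as the facet centers of the standard cube.\<close>

definition axis_vectors :: "'a::euclidean_space set" where
  "axis_vectors = Basis \<union> uminus ` Basis"

abbreviation std_cube :: "'a::euclidean_space set" where
  "std_cube \<equiv> cbox (- One) One"

lemma Basis_neg: "b \<in> Basis \<Longrightarrow> - b \<notin> Basis"
  for b :: "'a::euclidean_space"
  using inner_Basis[of b "- b"] by (auto split: if_splits)

lemma finite_axis_vectors: "finite (axis_vectors :: 'a::euclidean_space set)"
  by (simp add: axis_vectors_def)

lemma card_axis_vectors: "card (axis_vectors :: 'a::euclidean_space set) = 2 * DIM('a)"
proof -
  have "Basis \<inter> uminus ` Basis = ({} :: 'a set)"
    using Basis_neg by auto
  then show ?thesis
    by (simp add: axis_vectors_def card_Un_disjoint card_image)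
qed

lemma uminus_axis_vectors: "v \<in> axis_vectors \<Longrightarrow> - v \<in> axis_vectors"
  by (auto simp: axis_vectors_def)

lemma inner_axis_vectors_self: "v \<in> axis_vectors \<Longrightarrow> v \<bullet> v = 1"
  by (auto simp: axis_vectors_def)

lemma inner_axis_vectors:
  "v \<in> axis_vectors \<Longrightarrow> w \<in> axis_vectors \<Longrightarrow> v \<bullet> w = (if v = w then 1 else if v = - w then - 1 else 0)"
  using Basis_neg by (auto simp: axis_vectors_def inner_Basis)

lemma mem_std_cube_iff: "x \<in> std_cube \<longleftrightarrow> (\<forall>v\<in>axis_vectors. v \<bullet> x \<le> 1)"
proof -
  have "x \<in> std_cube \<longleftrightarrow> (\<forall>b\<in>Basis. - 1 \<le> x \<bullet> b \<and> x \<bullet> b \<le> 1)"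
    by (simp add: mem_box)
  also have "\<dots> \<longleftrightarrow> (\<forall>v\<in>axis_vectors. v \<bullet> x \<le> 1)"
    unfolding axis_vectors_def by (auto simp: inner_commute ball_Un)
  finally show ?thesis .
qed

lemma axis_vector_in_cube: "v \<in> axis_vectors \<Longrightarrow> v \<in> std_cube"
  unfolding mem_std_cube_iff by (simp add: inner_axis_vectors)

text \<open>The facets of a polyhedron can be read off from an irredundant system of half-spaces. The
  half-spaces \<open>v \<bullet> x \<le> 1\<close> are irredundant because \<open>2 *\<^sub>R v\<close> violates the one
  belonging to \<open>v\<close> and satisfies all the others.\<close>

lemma facets_std_cube:
  "facets (std_cube :: 'a::euclidean_space set) = (\<lambda>v. std_cube \<inter> {x. v \<bullet> x = 1}) ` axis_vectors"
proof -
  define H where "H = (\<lambda>v::'a. {x. v \<bullet> x \<le> 1})"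
  have not_in: "2 *\<^sub>R v \<notin> H v" if "v \<in> axis_vectors" for v
    using that by (simp add: H_def inner_axis_vectors_self)
  have in_other: "2 *\<^sub>R v \<in> H w" if "v \<in> axis_vectors" "w \<in> axis_vectors" "v \<noteq> w" for v w
    using that by (auto simp: H_def inner_axis_vectors)
  have inj: "inj_on H axis_vectors"
    using not_in in_other by (metis inj_onI)
  \<comment> \<open>The characterization of facets wants the normal as a function of the half-space.\<close>
  define a where "a = the_inv_into axis_vectors H"
  have a: "a (H v) = v" if "v \<in> axis_vectors" for v
    using the_inv_into_f_f[OF inj that] by (simp add: a_def)
  have "interior (std_cube :: 'a set) \<noteq> {}"
    by (simp add: interior_cbox box_ne_empty)
  then have aff: "affine hull (std_cube :: 'a set) = UNIV"
    by (rule affine_hull_nonempty_interior)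
  have cube: "std_cube = \<Inter> (H ` axis_vectors)"
    using mem_std_cube_iff by (auto simp: H_def)
  have "C facet_of std_cube \<longleftrightarrow> (\<exists>h. h \<in> H ` axis_vectors \<and> C = std_cube \<inter> {x. a h \<bullet> x = 1})" for C
  proof (rule facet_of_polyhedron_explicit)
    show "finite (H ` axis_vectors)" by (simp add: finite_axis_vectors)
    show "std_cube = affine hull std_cube \<inter> \<Inter> (H ` axis_vectors)"
      unfolding aff using cube by simp
    show "a h \<noteq> 0 \<and> h = {x. a h \<bullet> x \<le> 1}" if h: "h \<in> H ` axis_vectors" for h
    proof -
      obtain v where v: "v \<in> axis_vectors" "h = H v" using h by auto
      then have "v \<noteq> 0" using inner_axis_vectors_self[of v] by auto
      with v show ?thesis by (simp add: a) (simp add: H_def)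
    qed
    show "std_cube \<subset> affine hull std_cube \<inter> \<Inter> F'" if F': "F' \<subset> H ` axis_vectors" for F'
    proof -
      obtain v where v: "v \<in> axis_vectors" "H v \<notin> F'" using F' by auto
      have "2 *\<^sub>R v \<in> \<Inter> F'" using F' v in_other by blast
      moreover have "2 *\<^sub>R v \<notin> std_cube" using not_in v cube by auto
      moreover have "std_cube \<subseteq> \<Inter> F'" unfolding cube using F' by (intro Inter_anti_mono) auto
      ultimately show ?thesis unfolding aff by blast
    qed
  qed
  then show ?thesis
    by (auto simp: facets_def a image_iff)
qed

lemma center_std_cube: "center (std_cube :: 'a::euclidean_space set) = 0"
proof (rule center_point_symmetric)
  show "polytope (std_cube :: 'a set)" by (rule polytope_interval)
  show "(std_cube :: 'a set) \<noteq> {}" by (simp add: box_ne_empty)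
qed (auto simp: mem_box)

text \<open>The facet is symmetric about its normal vector \<open>v\<close>: the reflection \<open>x \<mapsto> 2v - x\<close>
  keeps the coordinate along \<open>v\<close> equal to 1 and changes the sign of all the others.\<close>

lemma facet_std_cube:
  assumes v: "v \<in> (axis_vectors :: 'a::euclidean_space set)"
  defines "T \<equiv> std_cube \<inter> {x. v \<bullet> x = 1}"
  shows "polytope T" "T \<noteq> {}" "center T = v"
proof -
  have "T facet_of std_cube" using facets_std_cube v by (auto simp: facets_def T_def)
  then show pt: "polytope T"
    using face_of_polytope_polytope[OF polytope_interval] facet_of_imp_face_of by blast
  show ne: "T \<noteq> {}"
    using inner_axis_vectors_self[OF v] axis_vector_in_cube[OF v] unfolding T_def by blast
  have "2 *\<^sub>R v - x \<in> T" if x: "x \<in> T" for x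
  proof -
    have "w \<bullet> (2 *\<^sub>R v - x) \<le> 1" if w: "w \<in> axis_vectors" for w
    proof -
      have "- w \<bullet> x \<le> 1" "v \<bullet> x = 1"
        using x uminus_axis_vectors[OF w] by (auto simp: T_def mem_std_cube_iff)
      then show ?thesis
        using inner_axis_vectors[OF w v] by (auto simp: inner_diff_right split: if_splits)
    qed
    then show ?thesis
      using x v by (auto simp: T_def mem_std_cube_iff inner_diff_right inner_axis_vectors_self)
  qed
  then show "center T = v"
    by (rule center_point_symmetric[OF pt ne])
qed

text \<open>If a coordinate of \<open>x\<close> is strictly between -1 and 1, then \<open>x\<close> can be moved a little in
  both directions along that axis, so it is not extreme. Conversely, 1 and -1 are extreme in
  \<open>[-1,1]\<close>, which forces the endpoints of any segment through a sign vector to agree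
  with it in each coordinate.\<close>

lemma vertices_std_cube:
  "vertices (std_cube :: 'a::euclidean_space set) = {x. \<forall>b\<in>Basis. \<bar>x \<bullet> b\<bar> = 1}"
proof (intro equalityI subsetI)
  fix x :: 'a assume "x \<in> vertices std_cube"
  then have x: "x extreme_point_of std_cube" by (simp add: vertices_def)
  have "\<bar>x \<bullet> b\<bar> = 1" if b: "b \<in> Basis" for b
  proof (rule ccontr)
    assume not1: "\<bar>x \<bullet> b\<bar> \<noteq> 1"
    define d where "d = 1 - \<bar>x \<bullet> b\<bar>"
    have le: "\<bar>x \<bullet> i\<bar> \<le> 1" if "i \<in> Basis" for i
      using x that by (auto simp: extreme_point_of_def mem_box)
    have d: "d > 0" using not1 le[OF b] by (simp add: d_def)
    have "x - d *\<^sub>R b \<in> std_cube" "x + d *\<^sub>R b \<in> std_cube"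
    proof -
      have "\<bar>(x - d *\<^sub>R b) \<bullet> i\<bar> \<le> 1 \<and> \<bar>(x + d *\<^sub>R b) \<bullet> i\<bar> \<le> 1" if i: "i \<in> Basis" for i
      proof (cases "i = b")
        case True
        then show ?thesis using d b unfolding d_def
          by (auto simp: inner_diff_left inner_add_left abs_le_iff)
      next
        case False
        then show ?thesis using le[OF i] b i
          by (simp add: inner_diff_left inner_add_left inner_Basis)
      qed
      then show "x - d *\<^sub>R b \<in> std_cube" "x + d *\<^sub>R b \<in> std_cube"
        by (auto simp: mem_box abs_le_iff minus_le_iff)
    qed
    moreover have "x \<in> open_segment (x - d *\<^sub>R b) (x + d *\<^sub>R b)"
    proof -
      have "midpoint (x - d *\<^sub>R b) (x + d *\<^sub>R b) = x"
        using scaleR_2[of x] by (simp add: midpoint_def)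
      moreover have "x - d *\<^sub>R b \<noteq> x + d *\<^sub>R b"
      proof
        assume "x - d *\<^sub>R b = x + d *\<^sub>R b"
        then have "(x - d *\<^sub>R b) \<bullet> b = (x + d *\<^sub>R b) \<bullet> b" by (rule arg_cong)
        then show False using d b by (simp add: inner_diff_left inner_add_left)
      qed
      ultimately show ?thesis by (metis midpoint_in_open_segment)
    qed
    ultimately show False using x by (auto simp: extreme_point_of_def)
  qed
  then show "x \<in> {x. \<forall>b\<in>Basis. \<bar>x \<bullet> b\<bar> = 1}" by simp
next
  fix x :: 'a assume "x \<in> {x. \<forall>b\<in>Basis. \<bar>x \<bullet> b\<bar> = 1}"
  then have x: "\<bar>x \<bullet> b\<bar> = 1" if "b \<in> Basis" for b using that by simp
  have "False" if ab: "p \<in> std_cube" "q \<in> std_cube" "x \<in> open_segment p q" for p q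
  proof -
    obtain u where u: "0 < u" "u < 1" "p \<noteq> q" "x = (1 - u) *\<^sub>R p + u *\<^sub>R q"
      using ab(3) by (auto simp: in_segment)
    have "p \<bullet> b = q \<bullet> b" if b: "b \<in> Basis" for b
    proof -
      define s t where "s = p \<bullet> b" and "t = q \<bullet> b"
      have st: "- 1 \<le> s" "s \<le> 1" "- 1 \<le> t" "t \<le> 1"
        using ab b by (auto simp: mem_box s_def t_def)
      have e: "x \<bullet> b = (1 - u) * s + u * t"
        using u by (simp add: inner_add_left s_def t_def)
      \<comment> \<open>For the bound that \<open>x\<close> attains, the weighted slacks of the endpoints add up to 0.\<close>
      have n: "0 \<le> (1-u)*(1-s)" "0 \<le> u*(1-t)" "0 \<le> (1-u)*(1+s)" "0 \<le> u*(1+t)"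
        using u st by auto
      consider "(1 - u) * s + u * t = 1" | "(1 - u) * s + u * t = - 1"
        using x[OF b] e by linarith
      then show ?thesis
      proof cases
        case 1
        then have "(1-u)*(1-s) + u*(1-t) = 0" by (simp add: algebra_simps)
        then have "(1-u)*(1-s) = 0" "u*(1-t) = 0" using n by linarith+
        then show ?thesis using u by (simp add: s_def t_def)
      next
        case 2
        then have "(1-u)*(1+s) + u*(1+t) = 0" by (simp add: algebra_simps)
        then have "(1-u)*(1+s) = 0" "u*(1+t) = 0" using n by linarith+
        then have "1 + s = 0" "1 + t = 0" using u by auto
        then show ?thesis by (simp add: s_def t_def)
      qed
    qed
    then have "p = q" by (rule euclidean_eqI)
    with u show False by simp
  qed
  moreover have "x \<in> std_cube"
  proof -
    have "- 1 \<le> x \<bullet> b \<and> x \<bullet> b \<le> 1" if "b \<in> Basis" for b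
      using x[OF that] by linarith
    then show ?thesis by (simp add: mem_box)
  qed
  ultimately show "x \<in> vertices std_cube"
    by (auto simp: vertices_def extreme_point_of_def)
qed

lemma card_vertices_std_cube: "card (vertices (std_cube :: 'a::euclidean_space set)) = 2 ^ DIM('a)"
proof -
  define sg where "sg = (\<lambda>A. \<Sum>i\<in>Basis. (if i \<in> A then 1 else - 1) *\<^sub>R (i::'a))"
  have sg: "sg A \<bullet> b = (if b \<in> A then 1 else - 1)" if "b \<in> Basis" for A b
    using that by (simp add: sg_def)
  have "bij_betw sg (Pow Basis) (vertices std_cube)"
  proof (rule bij_betwI[where g = "\<lambda>x. {b\<in>Basis. x \<bullet> b = 1}"])
    show "sg {b \<in> Basis. x \<bullet> b = 1} = x" if "x \<in> vertices std_cube" for x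
    proof (rule euclidean_eqI)
      fix b :: 'a assume b: "b \<in> Basis"
      then have "x \<bullet> b = 1 \<or> x \<bullet> b = - 1"
        using that unfolding vertices_std_cube by (auto simp: abs_eq_iff)
      then show "sg {b \<in> Basis. x \<bullet> b = 1} \<bullet> b = x \<bullet> b" using b by (auto simp: sg)
    qed
  qed (auto simp: vertices_std_cube sg split: if_splits)
  then show ?thesis
    by (metis bij_betw_same_card card_Pow finite_Basis)
qed

section \<open>Normal form of a hypercube\<close>

text \<open>Replacing \<open>[0,1]\<^sup>n\<close> by \<open>[-1,1]\<^sup>n\<close> halves the scaling factor and makes the
  translation part the center of the cube.\<close>

lemma hypercube_centered:
  fixes Q :: "'a::euclidean_space set"
  assumes "hypercube Q"
  obtains c :: 'a and r :: real and f :: "'a \<Rightarrow> 'a"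
  where "r > 0" "orthogonal_transformation f" "Q = (\<lambda>x. c + r *\<^sub>R f x) ` std_cube"
proof -
  obtain a :: 'a and s and f :: "'a \<Rightarrow> 'a" where s: "s > 0" and f: "orthogonal_transformation f"
    and Q: "Q = (\<lambda>x. a + s *\<^sub>R f x) ` cbox 0 One"
    using assms by (auto simp: hypercube_def)
  have "cbox 0 (One::'a) = (\<lambda>y. (1/2) *\<^sub>R y + (1/2) *\<^sub>R One) ` std_cube"
    using scaleR_left_distrib[of "1/2" "1/2" "One::'a"]
    by (subst image_affinity_cbox) (simp add: box_eq_empty)
  then have "Q = (\<lambda>y. (a + (s/2) *\<^sub>R f One) + (s/2) *\<^sub>R f y) ` std_cube"
    using orthogonal_transformation_linear[OF f]
    by (simp add: Q image_image linear_add linear_scale scaleR_add_right algebra_simps)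
  with s f show thesis by (intro that[of "s/2" f]) auto
qed

section \<open>Pairs of cross-polytope vertices\<close>

text \<open>Among the unordered pairs, the $n$ opposite ones contribute \<open>4 = 2\<^sup>2\<close> each, so the
  exponent of 2 is the number of all pairs plus $n$, that is ${2n \choose 2} + n = 2n^2$.\<close>

lemma prod_pairs_axis_vectors:
  fixes \<phi> :: "'a::euclidean_space set \<Rightarrow> real"
  assumes opp: "\<And>v. v \<in> axis_vectors \<Longrightarrow> \<phi> {v, - v} = 4"
    and orth: "\<And>v w. v \<in> axis_vectors \<Longrightarrow> w \<in> axis_vectors \<Longrightarrow> v \<noteq> w \<Longrightarrow> v \<noteq> - w \<Longrightarrow> \<phi> {v, w} = 2"
  shows "(\<Prod>p | p \<subseteq> axis_vectors \<and> card p = 2. \<phi> p) = 2 ^ (2 * DIM('a)\<^sup>2)"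
proof -
  let ?n = "DIM('a)"
  define P where "P = {p. p \<subseteq> (axis_vectors :: 'a set) \<and> card p = 2}"
  define A where "A = (\<lambda>b::'a. {b, - b}) ` Basis"
  have finP: "finite P"
    unfolding P_def by (rule finite_subset[OF _ finite_Pow_iff[THEN iffD2, OF finite_axis_vectors]]) auto
  have neq: "b \<noteq> - b" if "b \<in> Basis" for b :: 'a using Basis_neg[OF that] that by auto
  have AP: "A \<subseteq> P"
    using neq by (auto simp: A_def P_def axis_vectors_def)
  have cA: "card A = ?n"
    unfolding A_def using Basis_neg by (subst card_image) (auto simp: inj_on_def doubleton_eq_iff)
  have cP: "card P = (2 * ?n) choose 2"
    unfolding P_def using n_subsets[OF finite_axis_vectors] by (simp add: card_axis_vectors)
  have "prod \<phi> P = prod \<phi> (P - A) * prod \<phi> A"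
    by (rule prod.subset_diff[OF AP finP])
  also have "prod \<phi> A = (\<Prod>p\<in>A. 4)"
    by (rule prod.cong) (auto simp: A_def axis_vectors_def intro!: opp)
  also have "prod \<phi> (P - A) = (\<Prod>p\<in>P - A. 2)"
  proof (rule prod.cong[OF refl])
    fix p assume p: "p \<in> P - A"
    then obtain v w where vw: "p = {v, w}" "v \<noteq> w" "v \<in> axis_vectors" "w \<in> axis_vectors"
      by (auto simp: P_def card_2_iff)
    have "v \<noteq> - w"
    proof
      assume "v = - w"
      then have "p \<in> A" using vw by (auto simp: A_def axis_vectors_def insert_commute)
      with p show False by simp
    qed
    with vw show "\<phi> p = 2" by (simp add: orth)
  qed
  also have "(\<Prod>p\<in>P - A. 2) * (\<Prod>p\<in>A. 4) = (2::real) ^ (card (P - A) + 2 * card A)"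
    by (simp add: power_add power_mult)
  also have "card (P - A) + 2 * card A = card P + card A"
    using card_Diff_subset[OF finite_subset[OF AP finP] AP] card_mono[OF finP AP] by simp
  also have "\<dots> = 2 * ?n\<^sup>2"
  proof -
    have "2 * ?n choose 2 = ?n * (2 * ?n - 1)" by (simp add: choose_two)
    then show ?thesis
      using DIM_positive[where 'a='a] by (cases "?n") (simp_all add: cP cA power2_eq_square)
  qed
  finally show ?thesis by (simp add: P_def)
qed

text \<open>A segment determines its set of endpoints, and it is the convex hull of this set. So distinct
  segments correspond to two-element sets of endpoints.\<close>

lemma prod_segments_eq_prod_pairs:
  fixes g :: "'a::euclidean_space \<Rightarrow> 'a" and \<phi> :: "'a set \<Rightarrow> real"
  assumes "inj_on g D"
  shows "(\<Prod>S\<in>{closed_segment (g v) (g w) | v w. v \<in> D \<and> w \<in> D \<and> v \<noteq> w}. \<phi> S)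
       = (\<Prod>p | p \<subseteq> D \<and> card p = 2. \<phi> (convex hull (g ` p)))"
proof (rule prod.reindex_cong[where l = "\<lambda>p. convex hull (g ` p)"])
  show "inj_on (\<lambda>p. convex hull (g ` p)) {p. p \<subseteq> D \<and> card p = 2}"
  proof (rule inj_onI)
    fix p q assume p: "p \<in> {p. p \<subseteq> D \<and> card p = 2}" and q: "q \<in> {p. p \<subseteq> D \<and> card p = 2}"
      and eq: "convex hull (g ` p) = convex hull (g ` q)"
    obtain v w v' w' where "p = {v, w}" "q = {v', w'}" using p q by (auto simp: card_2_iff)
    with eq have "g ` p = g ` q" by (simp flip: segment_convex_hull)
    with p q show "p = q" using inj_on_image_eq_iff[OF assms] by simp
  qed
  show "{closed_segment (g v) (g w) | v w. v \<in> D \<and> w \<in> D \<and> v \<noteq> w}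
      = (\<lambda>p. convex hull (g ` p)) ` {p. p \<subseteq> D \<and> card p = 2}" (is "?L = ?R")
  proof (intro equalityI subsetI)
    fix S assume "S \<in> ?L"
    then obtain v w where "S = convex hull (g ` {v, w})" "v \<in> D" "w \<in> D" "v \<noteq> w"
      by (auto simp: segment_convex_hull)
    then show "S \<in> ?R" by (intro image_eqI[of _ _ "{v, w}"]) auto
  next
    fix S assume "S \<in> ?R"
    then show "S \<in> ?L" by (fastforce simp: card_2_iff segment_convex_hull)
  qed
qed auto

theorem corollary5p2:
  fixes Q :: "(real ^ 'n) set" and c :: "real ^ 'n"
    and V F N :: nat
    and seg :: "nat \<Rightarrow> (real ^ 'n) set" and s :: "nat \<Rightarrow> real"
  assumes "CARD('n) \<ge> 2"
    and "hypercube Q"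
    and "circumscribes Q c 1"
    and "V = card (vertices Q)"
    and "F = card (facets Q)"
    and "N = card (facet_center_segments Q)"
    and "bij_betw seg {1..N} (facet_center_segments Q)"
    and "\<And>i. i \<in> {1..N} \<Longrightarrow> s i = segment_length (seg i)"
  shows "(\<Prod>i=1..N. (s i)\<^sup>2) = real V ^ F"
proof -
  let ?D = "axis_vectors :: (real^'n) set"
  let ?T = "\<lambda>v. std_cube \<inter> {x::real^'n. v \<bullet> x = 1}"
  obtain m r f where r: "r > 0" and f: "orthogonal_transformation f"
    and Q: "Q = (\<lambda>x. m + r *\<^sub>R f x) ` (std_cube :: (real^'n) set)"
    by (rule hypercube_centered[OF assms(2)])
  have lin: "linear (\<lambda>x. r *\<^sub>R f x)"
    by (rule linear_compose_scale_right[OF orthogonal_transformation_linear[OF f]])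
  interpret affine_embedding "\<lambda>x. r *\<^sub>R f x" m
  proof (rule affine_embedding.intro)
    show "linear (\<lambda>x. r *\<^sub>R f x)" by (rule lin)
    show "inj (\<lambda>x. r *\<^sub>R f x)"
      using r orthogonal_transformation_inj[OF f] by (auto simp: inj_def)
  qed
  have Qg: "Q = g ` std_cube" by (simp add: Q g_def)
  have centerQ: "center Q = m"
  proof -
    have "center Q = g (center std_cube)"
      unfolding Qg
      by (rule center_image) (simp_all add: polytope_vertices polytope_interval box_ne_empty)
    also have "\<dots> = m + r *\<^sub>R f 0"
      by (simp add: center_std_cube g_def)
    finally show ?thesis
      by (simp add: linear_0[OF orthogonal_transformation_linear[OF f]])
  qed
  have center_facet: "center (g ` ?T v) = g v" if "v \<in> ?D" for v
    using center_image[of "?T v"] facet_std_cube[OF that] by (simp add: polytope_vertices)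
  have facetsQ: "facets Q = (\<lambda>v. g ` ?T v) ` ?D"
    by (simp add: Qg facets_image facets_std_cube image_image)
  have inj_facet: "inj_on (\<lambda>v. g ` ?T v) ?D"
    using center_facet inj_g by (metis (no_types, lifting) inj_onI injD)

  have dist_g: "dist (g v) (g w) = r * dist v w" for v w
  proof -
    have "g v - g w = r *\<^sub>R f (v - w)"
      using orthogonal_transformation_linear[OF f] by (simp add: g_def linear_diff algebra_simps)
    then show ?thesis
      using r orthogonal_transformation_norm[OF f] by (simp add: dist_norm)
  qed
  \<comment> \<open>A facet center lies on the unit sphere, but its distance from the center of the cube is \<open>r\<close>.\<close>
  have "r = 1"
  proof -
    obtain b :: "real^'n" where "b \<in> Basis" using nonempty_Basis by blast
    then have b: "b \<in> ?D" by (simp add: axis_vectors_def)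
    have "tangent_at (g ` ?T b) c 1 (g b)" and "c = m"
      using assms(3) b center_facet[OF b] centerQ unfolding circumscribes_def facetsQ by auto
    then have "dist m (g b) = 1"
      unfolding tangent_at_def by auto
    moreover have "norm (f b) = 1"
      using orthogonal_transformation_norm[OF f] \<open>b \<in> Basis\<close> by simp
    ultimately show ?thesis using r by (simp add: g_def dist_norm)
  qed
  then have "dist (g v) (g w) = dist v w" for v w
    unfolding dist_g by simp
  then have dist_sq: "(dist (g v) (g w))\<^sup>2 = 2 - 2 * (v \<bullet> w)" if "v \<in> ?D" "w \<in> ?D" for v w
    using that
    by (simp add: dist_norm power2_norm_eq_inner inner_diff inner_commute inner_axis_vectors_self)

  have segs: "facet_center_segments Q = {closed_segment (g v) (g w) | v w. v \<in> ?D \<and> w \<in> ?D \<and> v \<noteq> w}"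
  proof -
    have "facet_center_segments Q
        = {closed_segment (center (g ` ?T v)) (center (g ` ?T w)) | v w.
             v \<in> ?D \<and> w \<in> ?D \<and> g ` ?T v \<noteq> g ` ?T w}"
      unfolding facet_center_segments_def facetsQ by blast
    also have "\<dots> = {closed_segment (g v) (g w) | v w. v \<in> ?D \<and> w \<in> ?D \<and> v \<noteq> w}"
      using inj_on_eq_iff[OF inj_facet] center_facet by (intro Collect_cong ex_cong1) metis
    finally show ?thesis .
  qed
  have "(\<Prod>i=1..N. (s i)\<^sup>2) = (\<Prod>i=1..N. (segment_length (seg i))\<^sup>2)"
    using assms(8) by simp
  also have "\<dots> = (\<Prod>S\<in>facet_center_segments Q. (segment_length S)\<^sup>2)"
    by (rule prod.reindex_bij_betw[OF assms(7)])
  also have "\<dots> = (\<Prod>p | p \<subseteq> ?D \<and> card p = 2. (segment_length (convex hull (g ` p)))\<^sup>2)"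
    unfolding segs by (rule prod_segments_eq_prod_pairs[OF inj_on_subset[OF inj_g subset_UNIV]])
  also have "\<dots> = 2 ^ (2 * DIM(real^'n)\<^sup>2)"
    by (rule prod_pairs_axis_vectors)
      (simp_all add: dist_sq inner_axis_vectors uminus_axis_vectors inner_axis_vectors_self
        flip: segment_convex_hull)
  also have "\<dots> = real V ^ F"
  proof -
    have "V = 2 ^ DIM(real^'n)"
      using assms(4) card_vertices_std_cube[where 'a = "real^'n"]
      by (simp add: Qg vertices_image card_image[OF inj_on_subset[OF inj_g subset_UNIV]])
    moreover have "F = 2 * DIM(real^'n)"
      using assms(5) card_image[OF inj_facet] card_axis_vectors[where 'a = "real^'n"] by (simp add: facetsQ)
    ultimately show ?thesis
      by (simp add: power2_eq_square ac_simps flip: power_mult)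
  qed
  finally show ?thesis .
qed

end
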